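(* For any $\alpha\in(0,1/4)$ and $\epsilon_{\max}\in[0,1/2]$ there exists a constant $c>0$ depending only on $\alpha$ and $\epsilon_{\max}$ such that for all integers $m\ge 1$, all integers $n\ge 3$ satisfying $\epsilon_{\max}\ge \frac{2\alpha}{n}$, all $\epsilon\in[0,\epsilon_{\max}]$ and all $p\in[0,1]$, $$r_{\alpha}(\epsilon,p,\epsilon_{\max})\ \ge\ c\,\ell(n,\epsilon,m,p).$$
   Context: Let $n,m\ge 1$ be integers. For $\epsilon,p\in[0,1]$ and a probability distribution $Q$ on $\mathbb R$ put $P_{\epsilon,p,Q}=(1-\epsilon)\,\mathrm{Binomial}(m,p)+\epsilon Q$ (Huber contamination). The data $X_1,\dots,X_n$ are i.i.d. from $P_{\epsilon,p,Q}$, and $P_{\epsilon,p,Q}(E)$ denotes the probability of an event $E$ about $(X_1,\dots,X_n)$ under $P_{\epsilon,p,Q}^{\otimes n}$. Suprema and infima over $Q$ range over all probability distributions, and those over $p$ range over $[0,1]$. Write $a\wedge b=\min\{a,b\}$. An interval $[L,U]$ has length $|[L,U]|=U-L$ if $U\ge L$, and is empty (of length $0$) if $U<L$. The convention $1/\sqrt{\log(1/\epsilon)}=0$ is used for $\epsilon=0$. Class of confidence intervals: $$\mathcal I_\alpha(\epsilon_{\max})=\Big\{\widehat{\mathrm{CI}}=[l(\{X_i\}_{i=1}^n),u(\{X_i\}_{i=1}^n)]:\ \inf_{p,Q}P_{\epsilon_{\max},p,Q}\big(p\in\widehat{\mathrm{CI}}\big)\ge 1-\alpha\Big\}.$$ Locally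 optimal length: $$r_\alpha(\epsilon,p,\epsilon_{\max})=\inf\Big\{r\ge0:\ \inf_{\widehat{\mathrm{CI}}\in\mathcal I_\alpha(\epsilon_{\max})}\ \sup_Q P_{\epsilon,p,Q}\big(|\widehat{\mathrm{CI}}|\ge r\big)\le\alpha\Big\}.$$ Rate: $$\ell(n,\epsilon,m,p)=\left[\left(\sqrt{\tfrac{p(1-p)}{m}}\Big(\tfrac1{\sqrt{\log n}}+\tfrac1{\sqrt{\log(1/\epsilon)}}\Big)+\tfrac1m\right)\wedge p\wedge(1-p)\right]+\tfrac1m\Big(\tfrac1n+\epsilon\Big).$$ *)

theory Defs
  imports "HOL-Probability.Probability"
begin

definition binomial_real :: "nat \<Rightarrow> real \<Rightarrow> real measure" where
  "binomial_real m p = distr (measure_pmf (binomial_pmf m p)) borel real"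

definition real_dists :: "real measure set" where
  "real_dists = {Q. prob_space Q \<and> sets Q = sets borel}"

definition huber :: "nat \<Rightarrow> real \<Rightarrow> real \<Rightarrow> real measure \<Rightarrow> real measure" where
  "huber m \<epsilon> p Q = measure_of UNIV (sets borel)
     (\<lambda>A. ennreal (1 - \<epsilon>) * emeasure (binomial_real m p) A + ennreal \<epsilon> * emeasure Q A)"

definition huber_sample ::
  "nat \<Rightarrow> nat \<Rightarrow> real \<Rightarrow> real \<Rightarrow> real measure \<Rightarrow> (nat \<Rightarrow> real) measure" where
  "huber_sample n m \<epsilon> p Q = Pi\<^sub>M {..<n} (\<lambda>_. huber m \<epsilon> p Q)"

definition huber_prob ::
  "nat \<Rightarrow> nat \<Rightarrow> real \<Rightarrow> real \<Rightarrow> real measure \<Rightarrow> ((nat \<Rightarrow> real) \<Rightarrow> bool) \<Rightarrow> real" where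
  "huber_prob n m \<epsilon> p Q E =
     measure (huber_sample n m \<epsilon> p Q) {X \<in> space (huber_sample n m \<epsilon> p Q). E X}"

text \<open>A confidence interval is the pair \<open>(l, u)\<close> of its endpoint functions.  The set
  \<open>{l X..u X}\<close> is empty when \<open>u X < l X\<close>.\<close>

type_synonym ci = "((nat \<Rightarrow> real) \<Rightarrow> real) \<times> ((nat \<Rightarrow> real) \<Rightarrow> real)"

definition ci_set :: "ci \<Rightarrow> (nat \<Rightarrow> real) \<Rightarrow> real set" where
  "ci_set CI X = {fst CI X..snd CI X}"

definition ci_length :: "ci \<Rightarrow> (nat \<Rightarrow> real) \<Rightarrow> real" where
  "ci_length CI X = (if fst CI X \<le> snd CI X then snd CI X - fst CI X else 0)"

definition ci_class :: "nat \<Rightarrow> nat \<Rightarrow> real \<Rightarrow> real \<Rightarrow> ci set" where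
  "ci_class n m \<alpha> \<epsilon>max = {CI.
     fst CI \<in> borel_measurable (Pi\<^sub>M {..<n} (\<lambda>_. borel)) \<and>
     snd CI \<in> borel_measurable (Pi\<^sub>M {..<n} (\<lambda>_. borel)) \<and>
     (INF (p, Q) \<in> {0..1} \<times> real_dists. huber_prob n m \<epsilon>max p Q (\<lambda>X. p \<in> ci_set CI X)) \<ge> 1 - \<alpha>}"

text \<open>For \<open>\<epsilon>\<close>, \<open>\<epsilon>max\<close>, \<open>\<alpha>\<close> in \<open>[0, 1]\<close> every infimum and supremum in \<open>ci_class\<close> and \<open>opt_length\<close>
  is a real one over a nonempty bounded set: probabilities lie in \<open>[0, 1]\<close>, and \<open>ci_class_nonempty\<close> and \<open>opt_length_feasible\<close> below
  cover the other two index sets.\<close>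

definition opt_length :: "nat \<Rightarrow> nat \<Rightarrow> real \<Rightarrow> real \<Rightarrow> real \<Rightarrow> real \<Rightarrow> real" where
  "opt_length n m \<alpha> \<epsilon> p \<epsilon>max = Inf {r. 0 \<le> r \<and>
     (INF CI \<in> ci_class n m \<alpha> \<epsilon>max. SUP Q \<in> real_dists.
        huber_prob n m \<epsilon> p Q (\<lambda>X. ci_length CI X \<ge> r)) \<le> \<alpha>}"

definition inv_sqrt_log_inv :: "real \<Rightarrow> real" where
  "inv_sqrt_log_inv \<epsilon> = (if \<epsilon> = 0 then 0 else 1 / sqrt (ln (1 / \<epsilon>)))"

definition rate :: "nat \<Rightarrow> real \<Rightarrow> nat \<Rightarrow> real \<Rightarrow> real" where
  "rate n \<epsilon> m p =
     min (min (sqrt (p * (1 - p) / real m) * (1 / sqrt (ln (real n)) + inv_sqrt_log_inv \<epsilon>)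
               + 1 / real m) p) (1 - p)
     + 1 / real m * (1 / real n + \<epsilon>)"

lemma prob_space_binomial_real: "prob_space (binomial_real m p)"
  unfolding binomial_real_def
  by (intro prob_space.prob_space_distr measure_pmf.prob_space_axioms) simp

lemma sets_binomial_real [simp]: "sets (binomial_real m p) = sets borel"
  by (simp add: binomial_real_def)

lemma space_huber [simp]: "space (huber m \<epsilon> p Q) = UNIV"
  by (simp add: huber_def space_measure_of_conv)

lemma sets_huber [simp]: "sets (huber m \<epsilon> p Q) = sets borel"
  unfolding huber_def using sets.sigma_sets_eq[of "borel :: real measure"] by simp

lemma emeasure_huber:
  assumes "Q \<in> real_dists" and "A \<in> sets borel"
  shows "emeasure (huber m \<epsilon> p Q) A =
    ennreal (1 - \<epsilon>) * emeasure (binomial_real m p) A + ennreal \<epsilon> * emeasure Q A"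
proof (rule emeasure_measure_of[OF huber_def])
  show "countably_additive (sets (huber m \<epsilon> p Q))
     (\<lambda>A. ennreal (1 - \<epsilon>) * emeasure (binomial_real m p) A + ennreal \<epsilon> * emeasure Q A)"
  proof (rule countably_additiveI)
    fix A :: "nat \<Rightarrow> real set"
    assume A: "range A \<subseteq> sets (huber m \<epsilon> p Q)" "disjoint_family A"
    have "(\<Sum>i. emeasure (binomial_real m p) (A i)) = emeasure (binomial_real m p) (\<Union>i. A i)"
      using A by (intro suminf_emeasure) auto
    moreover have "(\<Sum>i. emeasure Q (A i)) = emeasure Q (\<Union>i. A i)"
      using A assms(1) by (intro suminf_emeasure) (auto simp: real_dists_def)
    ultimately show "(\<Sum>i. ennreal (1 - \<epsilon>) * emeasure (binomial_real m p) (A i)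
        + ennreal \<epsilon> * emeasure Q (A i)) =
      ennreal (1 - \<epsilon>) * emeasure (binomial_real m p) (\<Union>i. A i) + ennreal \<epsilon> * emeasure Q (\<Union>i. A i)"
      by (simp flip: suminf_add)
  qed
qed (use assms(2) in \<open>auto simp: positive_def\<close>)

lemma prob_space_huber:
  assumes "Q \<in> real_dists" and "0 \<le> \<epsilon>" "\<epsilon> \<le> 1"
  shows "prob_space (huber m \<epsilon> p Q)"
proof (rule prob_spaceI)
  have "emeasure (binomial_real m p) UNIV = 1"
    using prob_space.emeasure_space_1[OF prob_space_binomial_real[of m p]]
      sets_eq_imp_space_eq[OF sets_binomial_real[of m p]] by simp
  moreover have "emeasure Q UNIV = 1"
    using assms(1) prob_space.emeasure_space_1[of Q] sets_eq_imp_space_eq[of Q borel]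
    by (simp add: real_dists_def)
  ultimately show "emeasure (huber m \<epsilon> p Q) (space (huber m \<epsilon> p Q)) = 1"
    using assms by (simp add: emeasure_huber flip: ennreal_plus)
qed

lemma prob_space_huber_sample:
  assumes "Q \<in> real_dists" and "0 \<le> \<epsilon>" "\<epsilon> \<le> 1"
  shows "prob_space (huber_sample n m \<epsilon> p Q)"
  unfolding huber_sample_def by (intro prob_space_PiM prob_space_huber assms)

lemma real_dists_nonempty: "real_dists \<noteq> {}"
  using prob_space_binomial_real[of 0 0] by (auto simp: real_dists_def)

lemma huber_prob_bounds:
  assumes "Q \<in> real_dists" and "0 \<le> \<epsilon>" "\<epsilon> \<le> 1"
  shows "0 \<le> huber_prob n m \<epsilon> p Q E" "huber_prob n m \<epsilon> p Q E \<le> 1"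
  using prob_space.prob_le_1[OF prob_space_huber_sample[OF assms]]
  by (auto simp: huber_prob_def)

lemma ci_class_nonempty:
  assumes "0 \<le> \<epsilon>max" "\<epsilon>max \<le> 1" "0 \<le> \<alpha>"
  shows "((\<lambda>_. 0), (\<lambda>_. 1)) \<in> ci_class n m \<alpha> \<epsilon>max"
proof -
  have "1 \<le> (INF (p, Q) \<in> {0..1} \<times> real_dists.
      huber_prob n m \<epsilon>max p Q (\<lambda>X. p \<in> ci_set ((\<lambda>_. 0), (\<lambda>_. 1)) X))"
    using real_dists_nonempty prob_space.prob_space[OF prob_space_huber_sample] assms
    by (intro cINF_greatest) (auto simp: huber_prob_def ci_set_def)
  then show ?thesis using assms(3) by (auto simp: ci_class_def)
qed

lemma opt_length_feasible:
  assumes "0 \<le> \<epsilon>" "\<epsilon> \<le> 1" "0 \<le> \<epsilon>max" "\<epsilon>max \<le> 1" "0 \<le> \<alpha>"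
  shows "(INF CI \<in> ci_class n m \<alpha> \<epsilon>max. SUP Q \<in> real_dists.
        huber_prob n m \<epsilon> p Q (\<lambda>X. ci_length CI X \<ge> 2)) \<le> \<alpha>"
proof -
  let ?f = "\<lambda>CI. SUP Q \<in> real_dists. huber_prob n m \<epsilon> p Q (\<lambda>X. ci_length CI X \<ge> 2)"
  have "0 \<le> ?f CI" for CI
  proof -
    obtain Q where "Q \<in> real_dists" using real_dists_nonempty by auto
    then show ?thesis
      using huber_prob_bounds[OF _ assms(1,2)]
      by (intro cSUP_upper2[where x = Q] bdd_aboveI2[where M = 1]) auto
  qed
  then have "(INF CI \<in> ci_class n m \<alpha> \<epsilon>max. ?f CI) \<le> ?f ((\<lambda>_. 0), (\<lambda>_. 1))"
    using assms by (intro cINF_lower ci_class_nonempty bdd_belowI2[where m = 0]) auto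
  also have "\<dots> = 0"
    using real_dists_nonempty by (simp add: huber_prob_def ci_length_def)
  finally show ?thesis using assms by simp
qed

end

theory Submission
  imports Defs
begin

text \<open>The bound is a two-point argument.  Suppose that some contaminated law at \<open>p\<close>, of level at most \<open>\<epsilon>\<close>,
  can hardly be distinguished, from \<open>n\<close> observations, from a law at \<open>q\<close> contaminated at level \<open>\<epsilon>max\<close>.
  An interval with coverage \<open>1 - \<alpha>\<close> at level \<open>\<epsilon>max\<close> then contains both \<open>p\<close> and \<open>q\<close> with probability
  larger than \<open>\<alpha>\<close> by a fixed margin, so its length is at least \<open>\<bar>p - q\<bar>\<close> with that probability, and
  the optimal length is at least \<open>\<bar>p - q\<bar>\<close> (\<open>long_interval_probable\<close>, \<open>opt_length_ge\<close>).

  Take a level \<open>E\<close> of the order of \<open>\<epsilon> + 1 / n\<close> but at most \<open>3 / 4 * \<epsilon>max\<close>, namely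
  \<open>1 - E = (1 - e0) * (1 - \<eta>)\<close> with \<open>e0 = min \<epsilon> (\<epsilon>max / 2)\<close> and \<open>\<eta> = \<alpha> / (2 * n)\<close>.  The law at \<open>p\<close> with
  contamination \<open>S\<close> of level \<open>e0\<close>, times \<open>1 - \<eta>\<close>, is dominated by the law at \<open>p\<close> with contamination \<open>S\<close>
  of level \<open>E\<close>, and over \<open>n\<close> observations this costs only the constant factor \<open>(1 - \<eta>) ^ n \<ge> 1 - \<alpha> / 2\<close>.
  The law of level \<open>E\<close> is exactly a law at \<open>q\<close> of level \<open>\<epsilon>max\<close> for a suitable \<open>S\<close> as soon as the positive
  part of \<open>(1 - \<epsilon>max) * Binomial(m, q) - (1 - E) * Binomial(m, p)\<close> has mass at most \<open>E\<close>.

  It remains to move \<open>p\<close> as far as this condition permits (\<open>exists_shift\<close>).  By reflection, \<open>p \<le> 1/2\<close>.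
  Since \<open>1 - E\<close> exceeds \<open>1 - \<epsilon>max\<close> by a constant factor, only points where the likelihood ratio of \<open>q\<close> to
  \<open>p\<close> exceeds a constant contribute.  For \<open>q = p - d\<close> with \<open>d\<close> of order \<open>min p (1 / m)\<close> there are none.
  For \<open>d\<close> of order \<open>sqrt (p * (1 - p) / m) / sqrt (ln (1 / E))\<close> they lie so far in the lower tail that their
  mass is at most \<open>E\<close>.  If \<open>p\<close> is below \<open>E / (2 * m)\<close>, an upward shift by \<open>E / (2 * m)\<close> leaves excess at
  most \<open>E\<close>.  Together these shifts are of the order of the rate (\<open>rate_le_separation\<close>).\<close>

section \<open>Binomial masses and their ratio\<close>

text \<open>The mass of \<open>Binomial(m, p)\<close> at \<open>k\<close>, for arbitrary real \<open>p\<close>; it vanishes for \<open>k > m\<close>.\<close>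

definition bmass :: "nat \<Rightarrow> real \<Rightarrow> nat \<Rightarrow> real" where
  "bmass m p k = real (m choose k) * p ^ k * (1 - p) ^ (m - k)"

text \<open>The mass by which \<open>A\<close> times \<open>Binomial(m, q)\<close> exceeds \<open>D\<close> times \<open>Binomial(m, p)\<close>.  With
  \<open>A = 1 - \<epsilon>max\<close> and \<open>D = 1 - E\<close>, the condition \<open>excess m A q D p \<le> E\<close> says that contamination of
  weight \<open>E\<close> suffices to lift the law at \<open>p\<close> above the uncontaminated part of the law at \<open>q\<close>.\<close>

definition excess :: "nat \<Rightarrow> real \<Rightarrow> real \<Rightarrow> real \<Rightarrow> real \<Rightarrow> real" where
  "excess m A q D p = (\<Sum>k\<le>m. max 0 (A * bmass m q k - D * bmass m p k))"

lemma bmass_nonneg: "0 \<le> p \<Longrightarrow> p \<le> 1 \<Longrightarrow> 0 \<le> bmass m p k"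
  by (simp add: bmass_def)

lemma bmass_outside: "k > m \<Longrightarrow> bmass m p k = 0"
  by (simp add: bmass_def)

lemma sum_bmass: "(\<Sum>k\<le>m. bmass m p k) = 1"
  using binomial_ring[of p "1 - p" m] by (simp add: bmass_def)

lemma bmass_laplace: "(\<Sum>k\<le>m. bmass m p k * exp (- (s * real k))) = (1 - p + p * exp (- s)) ^ m"
proof -
  have "(1 - p + p * exp (- s)) ^ m = (p * exp (- s) + (1 - p)) ^ m"
    by (simp add: add.commute)
  also have "\<dots> = (\<Sum>k\<le>m. real (m choose k) * (p * exp (- s)) ^ k * (1 - p) ^ (m - k))"
    by (rule binomial_ring)
  also have "\<dots> = (\<Sum>k\<le>m. bmass m p k * exp (- (s * real k)))"
    by (intro sum.cong) (auto simp: bmass_def power_mult_distrib mult_ac simp flip: exp_of_nat_mult)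
  finally show ?thesis by simp
qed

lemma bmass_reflect: "k \<le> m \<Longrightarrow> bmass m (1 - p) k = bmass m p (m - k)"
  by (simp add: bmass_def binomial_symmetric[of k m] mult_ac)

lemma excess_reflect: "excess m A (1 - q) D (1 - p) = excess m A q D p"
proof -
  have "excess m A (1 - q) D (1 - p)
      = (\<Sum>k\<le>m. max 0 (A * bmass m q (m - k) - D * bmass m p (m - k)))"
    unfolding excess_def by (intro sum.cong) (auto simp: bmass_reflect)
  also have "\<dots> = (\<Sum>k\<le>m. max 0 (A * bmass m q k - D * bmass m p k))"
    by (rule sum.reindex_bij_witness[of _ "\<lambda>k. m - k" "\<lambda>k. m - k"]) auto
  finally show ?thesis by (simp add: excess_def)
qed

text \<open>Moving the success probability down by \<open>d\<close> changes each mass by at most an exponential factor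
  in \<open>d * (m * p - k)\<close>: both factors of the likelihood ratio are bounded by \<open>1 + x \<le> exp x\<close>.  So a
  point \<open>k\<close> contributes to the excess only if it lies far below the mean.\<close>

lemma bmass_ratio_le:
  assumes "0 < p" "p < 1" "0 \<le> d" "d \<le> p" "k \<le> m"
  shows "bmass m (p - d) k \<le> bmass m p k * exp (d * (real m * p - real k) / (p * (1 - p)))"
proof -
  have "1 - d / p \<le> exp (- (d / p))" using exp_ge_add_one_self[of "- (d / p)"] by simp
  then have "p * (1 - d / p) \<le> p * exp (- (d / p))" using assms by (intro mult_left_mono) auto
  then have 1: "p - d \<le> p * exp (- (d / p))" using assms by (simp add: right_diff_distrib)
  have "1 + d / (1 - p) \<le> exp (d / (1 - p))" by (rule exp_ge_add_one_self)
  then have "(1 - p) * (1 + d / (1 - p)) \<le> (1 - p) * exp (d / (1 - p))"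
    using assms by (intro mult_left_mono) auto
  then have 2: "1 - (p - d) \<le> (1 - p) * exp (d / (1 - p))" using assms by (simp add: distrib_left)
  have "(p - d) ^ k \<le> (p * exp (- (d / p))) ^ k" using 1 assms by (intro power_mono) auto
  moreover have "(1 - (p - d)) ^ (m - k) \<le> ((1 - p) * exp (d / (1 - p))) ^ (m - k)"
    using 2 assms by (intro power_mono) auto
  ultimately have "(p - d) ^ k * (1 - (p - d)) ^ (m - k)
      \<le> (p * exp (- (d / p))) ^ k * ((1 - p) * exp (d / (1 - p))) ^ (m - k)"
    using assms by (intro mult_mono) auto
  also have "\<dots> = p ^ k * (1 - p) ^ (m - k)
      * (exp (real k * - (d / p)) * exp (real (m - k) * (d / (1 - p))))"
    unfolding exp_of_nat_mult by (simp add: power_mult_distrib mult_ac)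
  also have "exp (real k * - (d / p)) * exp (real (m - k) * (d / (1 - p)))
      = exp (real k * - (d / p) + real (m - k) * (d / (1 - p)))"
    by (rule exp_add[symmetric])
  also have "real k * - (d / p) + real (m - k) * (d / (1 - p))
      = d * (real m * p - real k) / (p * (1 - p))"
    using assms by (simp add: field_simps of_nat_diff)
  finally show ?thesis
    unfolding bmass_def mult.assoc by (intro mult_left_mono) (auto simp: mult_ac)
qed

lemma excess_term_eq_0:
  assumes "0 < p" "p < 1" "0 \<le> d" "d \<le> p" "k \<le> m" "0 \<le> A" "A * exp a \<le> D"
    and "d * (real m * p - real k) \<le> a * (p * (1 - p))"
  shows "max 0 (A * bmass m (p - d) k - D * bmass m p k) = 0"
proof -
  have "d * (real m * p - real k) / (p * (1 - p)) \<le> a" using assms by (simp add: field_simps)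
  then have "bmass m (p - d) k \<le> bmass m p k * exp a"
    using bmass_ratio_le[OF assms(1-5)] bmass_nonneg[of p m k] assms
    by (meson exp_le_cancel_iff less_imp_le mult_left_mono order_trans)
  then have "A * bmass m (p - d) k \<le> A * (bmass m p k * exp a)"
    using assms by (intro mult_left_mono) auto
  also have "\<dots> = A * exp a * bmass m p k" by simp
  also have "\<dots> \<le> D * bmass m p k"
    using assms by (intro mult_right_mono bmass_nonneg) auto
  finally show ?thesis by simp
qed

section \<open>Shifts with small excess\<close>

text \<open>A downward shift of order \<open>1 / m\<close> changes every mass by a bounded factor only.\<close>

lemma excess_eq_0:
  assumes "0 < p" "p \<le> 1/2" "0 \<le> d" "d \<le> p" "0 \<le> A" "A * exp a \<le> D" "2 * real m * d \<le> a"
  shows "excess m A (p - d) D p = 0"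
  unfolding excess_def
proof (intro sum.neutral ballI)
  fix k assume k: "k \<in> {..m}"
  have "d * (real m * p - real k) \<le> d * (real m * p)" using assms by (intro mult_left_mono) auto
  also have "\<dots> = 2 * real m * d * (p * (1/2))" by simp
  also have "\<dots> \<le> 2 * real m * d * (p * (1 - p))"
    using assms by (intro mult_left_mono) auto
  also have "\<dots> \<le> a * (p * (1 - p))" using assms by (intro mult_right_mono) auto
  finally show "max 0 (A * bmass m (p - d) k - D * bmass m p k) = 0"
    using assms k by (intro excess_term_eq_0) auto
qed

lemma exp_minus_le_quadratic:
  assumes "0 \<le> (x::real)" shows "exp (- x) \<le> 1 - x + x\<^sup>2 / 2"
proof -
  have pos: "0 \<le> 1 - x + x\<^sup>2 / 2"
    using zero_le_power2[of "x - 1"] by (simp add: power2_eq_square algebra_simps)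
  have "(1 - x + x\<^sup>2 / 2) * (1 + x + x\<^sup>2 / 2) = 1 + (x\<^sup>2)\<^sup>2 / 4"
    by (simp add: power2_eq_square algebra_simps)
  then have "1 \<le> (1 - x + x\<^sup>2 / 2) * (1 + x + x\<^sup>2 / 2)" by simp
  also have "\<dots> \<le> (1 - x + x\<^sup>2 / 2) * exp x"
    using pos assms by (intro mult_left_mono exp_lower_Taylor_quadratic)
  finally show ?thesis by (simp add: exp_minus field_simps)
qed

text \<open>Chernoff bound: the contributing points satisfy \<open>m * p - k > t\<close> for
  \<open>t = a * p * (1 - p) / d\<close>, and their mass under \<open>Binomial(m, p - d)\<close> is bounded through the Laplace
  transform at \<open>s\<close>.  Going downwards, the tail is sub-Gaussian for every \<open>p\<close>.\<close>

lemma excess_le_exp: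
  assumes "0 < p" "p < 1" "0 < d" "d \<le> p" "0 \<le> A" "A \<le> 1" "A * exp a \<le> D" "0 \<le> s"
  shows "excess m A (p - d) D p
    \<le> exp (s * real m * d - s * (a * (p * (1 - p)) / d) + real m * p * s\<^sup>2 / 2)"
proof -
  define t where "t = a * (p * (1 - p)) / d"
  have D: "0 \<le> D" using assms by (meson exp_ge_zero mult_nonneg_nonneg order_trans)
  have "max 0 (A * bmass m (p - d) k - D * bmass m p k)
      \<le> bmass m (p - d) k * exp (s * (real m * p - real k - t))" if "k \<le> m" for k
  proof (cases "d * (real m * p - real k) \<le> a * (p * (1 - p))")
    case True
    then have "max 0 (A * bmass m (p - d) k - D * bmass m p k) = 0"
      using assms that by (intro excess_term_eq_0) auto
    then show ?thesis using bmass_nonneg[of "p - d" m k] assms by simp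
  next
    case False
    then have "0 \<le> real m * p - real k - t" using assms by (simp add: t_def field_simps)
    then have e: "1 \<le> exp (s * (real m * p - real k - t))" using assms by simp
    have b: "0 \<le> bmass m (p - d) k" "0 \<le> bmass m p k" using assms by (auto intro: bmass_nonneg)
    have "A * bmass m (p - d) k \<le> 1 * bmass m (p - d) k"
      using assms b by (intro mult_right_mono) auto
    then have "max 0 (A * bmass m (p - d) k - D * bmass m p k) \<le> bmass m (p - d) k * 1"
      using b mult_nonneg_nonneg[OF D b(2)] by (intro max.boundedI) linarith+
    also have "\<dots> \<le> bmass m (p - d) k * exp (s * (real m * p - real k - t))"
      using b e by (intro mult_left_mono) auto
    finally show ?thesis .
  qed
  then have "excess m A (p - d) D p
      \<le> (\<Sum>k\<le>m. bmass m (p - d) k * exp (s * (real m * p - real k - t)))"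
    unfolding excess_def by (intro sum_mono) auto
  also have "\<dots> = exp (s * (real m * p - t)) * (\<Sum>k\<le>m. bmass m (p - d) k * exp (- (s * real k)))"
    unfolding sum_distrib_left
    by (intro sum.cong refl) (simp add: algebra_simps flip: exp_add)
  also have "(\<Sum>k\<le>m. bmass m (p - d) k * exp (- (s * real k)))
      = (1 - (p - d) + (p - d) * exp (- s)) ^ m"
    by (rule bmass_laplace)
  also have "\<dots> \<le> exp ((p - d) * (- s + s\<^sup>2 / 2)) ^ m"
  proof (rule power_mono)
    have "1 - (p - d) + (p - d) * exp (- s) \<le> 1 - (p - d) + (p - d) * (1 - s + s\<^sup>2 / 2)"
      using exp_minus_le_quadratic[of s] assms by (intro add_left_mono mult_left_mono) auto
    also have "\<dots> = 1 + (p - d) * (- s + s\<^sup>2 / 2)" by (simp add: algebra_simps)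
    also have "\<dots> \<le> exp ((p - d) * (- s + s\<^sup>2 / 2))" by (rule exp_ge_add_one_self)
    finally show "1 - (p - d) + (p - d) * exp (- s) \<le> exp ((p - d) * (- s + s\<^sup>2 / 2))" .
  qed (use assms in auto)
  also have "\<dots> = exp (real m * ((p - d) * (- s + s\<^sup>2 / 2)))" by (simp add: exp_of_nat_mult)
  also have "exp (s * (real m * p - t)) * \<dots>
      = exp (s * (real m * p - t) + real m * ((p - d) * (- s + s\<^sup>2 / 2)))"
    by (simp add: exp_add)
  also have "\<dots> \<le> exp (s * real m * d - s * t + real m * p * s\<^sup>2 / 2)"
  proof -
    have "0 \<le> real m * d * s\<^sup>2 / 2" using assms by simp
    then show ?thesis by (simp add: algebra_simps)
  qed
  finally show ?thesis by (simp add: t_def mult_left_mono)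
qed

lemma ln_inverse_ge_half:
  assumes "0 < E" "E \<le> 1/2" shows "1/2 \<le> ln (1 / E :: real)"
proof -
  have "1/2 \<le> ln (2::real)" using exp_half_le2 by (subst ln_ge_iff) auto
  also have "\<dots> \<le> ln (1 / E)" using assms by (intro ln_mono) (auto simp: field_simps)
  finally show ?thesis .
qed

text \<open>With \<open>L = ln (1 / E)\<close>, a shift of \<open>a / 3\<close> standard deviations of \<open>k / m\<close>, divided by \<open>sqrt L\<close>,
  leaves excess at most \<open>exp (- L) = E\<close>.\<close>

lemma excess_le_sqrt_shift:
  assumes "1 \<le> m" "0 < p" "p \<le> 1/2" "0 < a" "a \<le> 1" "0 < E" "E \<le> 1/2"
    "0 \<le> A" "A \<le> 1" "A * exp a \<le> D"
    and d: "d = a / 3 * (sqrt (p * (1 - p) / real m) / sqrt (ln (1 / E)))" and "d \<le> p"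
  shows "excess m A (p - d) D p \<le> E"
proof -
  define L where "L = ln (1 / E)"
  define v where "v = real m * (p * (1 - p))"
  \<comment> \<open>This choice makes the exponent at most \<open>a / 2 - 9 / 2 * L + 9 / 4 * L\<close>.\<close>
  define s where "s = 3 / 2 * (sqrt L / sqrt v)"
  have L: "1/2 \<le> L" using ln_inverse_ge_half assms by (simp add: L_def)
  have v: "0 < v" using assms by (simp add: v_def)
  have m: "0 < real m" using assms by simp
  have "sqrt (p * (1 - p) / real m) = sqrt (v / (real m)\<^sup>2)"
    using m by (simp add: v_def power2_eq_square)
  then have dd: "d = a / 3 * (sqrt v / (real m * sqrt L))"
    using m by (simp add: d L_def real_sqrt_divide)
  have dpos: "0 < d" using dd assms m v L by simp
  have "excess m A (p - d) D p
    \<le> exp (s * real m * d - s * (a * (p * (1 - p)) / d) + real m * p * s\<^sup>2 / 2)"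
    using assms dpos v L by (intro excess_le_exp) (auto simp: s_def)
  also have "s * real m * d = a / 2"
    using v L m by (simp add: s_def dd)
  also have "s * (a * (p * (1 - p)) / d) = 9 / 2 * L"
  proof -
    have "p * (1 - p) = sqrt v * sqrt v / real m" using m v by (simp add: v_def)
    moreover have "3 / 2 * (y / x) * (a * (x * x / M) / (a / 3 * (x / (M * y)))) = 9 / 2 * (y * y)"
      if "0 < x" "0 < y" "0 < M" for x y M :: real
      using that assms by (simp add: field_simps)
    from this[of "sqrt v" "sqrt L" "real m"]
    have "3 / 2 * (sqrt L / sqrt v) * (a * (sqrt v * sqrt v / real m) / (a / 3 * (sqrt v / (real m * sqrt L))))
        = 9 / 2 * (sqrt L * sqrt L)"
      using m v L by simp
    ultimately have "s * (a * (p * (1 - p)) / d) = 9 / 2 * (sqrt L * sqrt L)"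
      unfolding s_def dd by metis
    then show ?thesis using L by simp
  qed
  also have "a / 2 - 9 / 2 * L + real m * p * s\<^sup>2 / 2 \<le> - L"
  proof -
    have "real m * p * s\<^sup>2 / 2 = 9 / 8 * L * (real m * p / v)"
      using v L by (simp add: s_def power_mult_distrib power_divide)
    also have "real m * p / v = 1 / (1 - p)" using assms m by (simp add: v_def)
    also have "\<dots> \<le> 2" using assms by (simp add: field_simps)
    finally have "real m * p * s\<^sup>2 / 2 \<le> 9 / 8 * L * 2" using L by (simp add: mult_left_mono)
    then show ?thesis using L assms(5) by linarith
  qed
  also have "exp (- L) = E" using assms by (simp add: L_def exp_minus)
  finally show ?thesis by simp
qed

text \<open>An upward shift, needed when \<open>p\<close> is so close to \<open>0\<close> that there is no room below: only the points
  \<open>k \<ge> 1\<close> contribute.\<close>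

lemma excess_le_near_0:
  assumes "0 \<le> p" "p \<le> q" "q \<le> 1" "0 \<le> A" "A \<le> D" "A \<le> 1"
  shows "excess m A q D p \<le> real m * q"
proof -
  have b: "0 \<le> bmass m q k" "0 \<le> bmass m p k" for k using assms by (auto intro: bmass_nonneg)
  have "max 0 (A * bmass m q k - D * bmass m p k) \<le> (if k = 0 then 0 else bmass m q k)" for k
  proof (cases "k = 0")
    case True
    have "bmass m q 0 \<le> bmass m p 0" using assms by (auto simp: bmass_def intro: power_mono)
    then have "A * bmass m q 0 \<le> D * bmass m p 0" using assms b by (intro mult_mono) auto
    then show ?thesis using True by simp
  next
    case False
    have "A * bmass m q k \<le> 1 * bmass m q k" using assms b by (intro mult_right_mono) auto
    moreover have "0 \<le> D * bmass m p k" using assms b by simp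
    ultimately have "A * bmass m q k - D * bmass m p k \<le> bmass m q k" by linarith
    then show ?thesis using False b by simp
  qed
  then have "excess m A q D p \<le> (\<Sum>k\<le>m. if k = 0 then 0 else bmass m q k)"
    unfolding excess_def by (intro sum_mono)
  also have "\<dots> = (\<Sum>k\<le>m. bmass m q k - (if k = 0 then bmass m q 0 else 0))"
    by (intro sum.cong) auto
  also have "\<dots> = 1 - (1 - q) ^ m"
    by (simp add: sum_subtractf sum_bmass) (simp add: bmass_def)
  also have "\<dots> \<le> real m * q" using Bernoulli_inequality[of "- q" m] assms by simp
  finally show ?thesis .
qed

text \<open>The distance, up to constants, over which contamination at level \<open>E\<close> hides a change of \<open>p\<close>.  It is
  the rate with the two logarithmic terms merged into one and with \<open>1 / n + \<epsilon>\<close> replaced by \<open>E\<close>.\<close>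

definition separation :: "nat \<Rightarrow> real \<Rightarrow> real \<Rightarrow> real" where
  "separation m E p = min (min (sqrt (p * (1 - p) / real m) / sqrt (ln (1 / E)) + 1 / real m) p) (1 - p)
     + E / real m"

lemma exists_shift_lower_half:
  assumes "1 \<le> m" "0 \<le> p" "p \<le> 1/2" "0 < a" "a \<le> 1" "0 < E" "E \<le> 1/2"
    "0 \<le> A" "A \<le> 1" "A * exp a \<le> D"
  shows "\<exists>q. 0 \<le> q \<and> q \<le> 1 \<and> excess m A q D p \<le> E \<and> a / 9 * separation m E p \<le> \<bar>p - q\<bar>"
proof -
  define M where "M = 1 / real m"
  define S where "S = sqrt (p * (1 - p) / real m) / sqrt (ln (1 / E))"
  have L: "1/2 \<le> ln (1 / E)" using assms ln_inverse_ge_half by simp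
  have M: "0 < M" "M \<le> 1" using assms by (auto simp: M_def)
  have AD: "A \<le> D"
  proof -
    have "A * 1 \<le> A * exp a" using assms by (intro mult_left_mono) auto
    then show ?thesis using assms by simp
  qed
  have EM: "E * M \<le> M / 2" using mult_right_mono[of E "1/2" M] assms M by simp
  have EM0: "0 < E * M" using assms M by simp
  have sep: "separation m E p \<le> S + M + E * M" "separation m E p \<le> p + E * M"
    by (auto simp: separation_def S_def M_def)
  have cut: "a / 9 * separation m E p \<le> a / 9 * x" if "separation m E p \<le> x" for x
    using that assms by (intro mult_left_mono) auto
  have ax: "a * x \<le> x" if "0 \<le> x" for x using mult_right_mono[of a 1 x] that assms by simp
  \<comment> \<open>The term that dominates the separation: \<open>E / m\<close>, \<open>p\<close>, \<open>1 / m\<close> or the standard deviation.\<close>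
  consider "p < E * M / 2" | "E * M / 2 \<le> p" "p \<le> M" | "M \<le> p" "S \<le> M" | "M \<le> p" "M \<le> S"
    by linarith
  then show ?thesis
  proof cases
    case 1
    have q: "p + E * M / 2 \<le> E * M" "p + E * M / 2 \<le> 1" using 1 EM M by linarith+
    have "excess m A (p + E * M / 2) D p \<le> real m * (p + E * M / 2)"
      using assms AD EM0 by (intro excess_le_near_0 q(2)) auto
    also have "\<dots> \<le> real m * (E * M)" using q by (intro mult_left_mono) auto
    also have "\<dots> = E" using assms by (simp add: M_def)
    finally have "excess m A (p + E * M / 2) D p \<le> E" .
    moreover have "a / 9 * separation m E p \<le> E * M / 2"
    proof -
      have "a / 9 * separation m E p \<le> a / 9 * (3 / 2 * (E * M))" using sep 1 by (intro cut) auto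
      also have "\<dots> = a * (E * M) / 6" by simp
      also have "\<dots> \<le> E * M / 2" using ax[of "E * M"] EM0 by linarith
      finally show ?thesis .
    qed
    ultimately show ?thesis using q(2) EM0 assms
      by (intro exI[of _ "p + E * M / 2"]) auto
  next
    case 2
    define d where "d = a / 2 * p"
    have p: "0 < p" using 2 EM0 by simp
    have d: "0 < d" "d \<le> p"
      using mult_pos_pos[OF assms(4) p] ax[of p] p unfolding d_def by linarith+
    have "2 * real m * d = a * (real m * p)" by (simp add: d_def)
    also have "\<dots> \<le> a * 1" using 2 assms by (intro mult_left_mono) (auto simp: M_def field_simps)
    finally have "excess m A (p - d) D p = 0"
      using assms p d by (intro excess_eq_0[where a = a]) auto
    moreover have "a / 9 * separation m E p \<le> d"
      using cut[of "3 * p"] sep 2 p assms by (simp add: d_def)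
    ultimately show ?thesis using p d assms
      by (intro exI[of _ "p - d"]) auto
  next
    case 3
    define d where "d = a / 2 * M"
    have d: "0 < d" "d \<le> p"
      using mult_pos_pos[OF assms(4) M(1)] ax[of M] M 3(1) unfolding d_def by linarith+
    have p: "0 < p" using 3 M by simp
    have "2 * real m * d = a" using assms by (simp add: d_def M_def)
    then have "excess m A (p - d) D p = 0"
      using assms p d by (intro excess_eq_0[where a = a]) auto
    moreover have "a / 9 * separation m E p \<le> d"
    proof -
      have "a / 9 * separation m E p \<le> a / 9 * (3 * M)" using sep 3 EM M by (intro cut) linarith
      then show ?thesis using mult_pos_pos[of a M] assms M by (simp add: d_def)
    qed
    ultimately show ?thesis using p d assms
      by (intro exI[of _ "p - d"]) auto
  next
    case 4
    define d where "d = a / 3 * S"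
    have p: "0 < p" using 4 M by simp
    have "p * (1 - p) / real m \<le> p * 1 * M"
      unfolding M_def using assms by (simp add: divide_right_mono mult_left_le)
    also have "\<dots> \<le> p * p" using 4 p by (simp add: mult_left_mono)
    finally have "sqrt (p * (1 - p) / real m) \<le> sqrt (p * p)" by (rule real_sqrt_le_mono)
    then have s: "sqrt (p * (1 - p) / real m) \<le> p" using p by simp
    have "1 / 2 \<le> sqrt (ln (1 / E))" using L by (intro real_le_rsqrt) (auto simp: power2_eq_square)
    then have "S \<le> p / (1/2)" unfolding S_def using s p assms by (intro frac_le) auto
    then have S: "S \<le> 2 * p" by simp
    have S0: "0 < S" using 4 M by simp
    have "a * S \<le> 2 * p" using ax[OF less_imp_le[OF S0]] S by linarith
    then have d: "0 < d" "d \<le> p"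
      using mult_pos_pos[OF assms(4) S0] p unfolding d_def by linarith+
    have "excess m A (p - d) D p \<le> E"
      using assms p d by (intro excess_le_sqrt_shift) (auto simp: d_def S_def)
    moreover have "separation m E p \<le> 3 * S" using sep 4 EM M by linarith
    then have "a / 9 * separation m E p \<le> d" using cut[of "3 * S"] by (simp add: d_def mult_ac)
    ultimately show ?thesis using p d assms
      by (intro exI[of _ "p - d"]) auto
  qed
qed

lemma exists_shift:
  assumes "1 \<le> m" "0 \<le> p" "p \<le> 1" "0 < a" "a \<le> 1" "0 < E" "E \<le> 1/2"
    "0 \<le> A" "A \<le> 1" "A * exp a \<le> D"
  shows "\<exists>q. 0 \<le> q \<and> q \<le> 1 \<and> excess m A q D p \<le> E \<and> a / 9 * separation m E p \<le> \<bar>p - q\<bar>"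
proof (cases "p \<le> 1/2")
  case True
  then show ?thesis using assms by (intro exists_shift_lower_half) auto
next
  case False
  then obtain q where q: "0 \<le> q" "q \<le> 1" "excess m A q D (1 - p) \<le> E"
      "a / 9 * separation m E (1 - p) \<le> \<bar>1 - p - q\<bar>"
    using exists_shift_lower_half[of m "1 - p" a E A D] assms by auto
  have "separation m E (1 - p) = separation m E p"
    by (simp add: separation_def mult.commute min.commute min.left_commute)
  moreover have "\<bar>1 - p - q\<bar> = \<bar>p - (1 - q)\<bar>" by linarith
  ultimately show ?thesis using q excess_reflect[of m A q D "1 - p"]
    by (intro exI[of _ "1 - q"]) auto
qed

section \<open>Domination of contaminated samples\<close>

text \<open>Domination of measures up to the factor \<open>c\<close> passes to powers, with factor \<open>c ^ card I\<close>.\<close>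

lemma nn_integral_PiM_le:
  assumes "finite I" "prob_space M" "prob_space N" "sets M = sets N"
    and dom: "\<And>A. A \<in> sets N \<Longrightarrow> ennreal c * emeasure M A \<le> emeasure N A"
    and "f \<in> borel_measurable (Pi\<^sub>M I (\<lambda>_. N))"
  shows "ennreal c ^ card I * (\<integral>\<^sup>+ x. f x \<partial>Pi\<^sub>M I (\<lambda>_. M)) \<le> (\<integral>\<^sup>+ x. f x \<partial>Pi\<^sub>M I (\<lambda>_. N))"
  using assms(1,6)
proof (induction I arbitrary: f)
  case empty
  have "(\<integral>\<^sup>+ x. f x \<partial>Pi\<^sub>M {} (\<lambda>_. M)) = (\<integral>\<^sup>+ x. f x \<partial>Pi\<^sub>M {} (\<lambda>_. N))"
    by (intro arg_cong[where f = "\<lambda>K. nn_integral K f"] PiM_cong) auto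
  then show ?case by simp
next
  case (insert i I)
  interpret M: product_sigma_finite "\<lambda>_. M"
    by (intro product_sigma_finite.intro prob_space_imp_sigma_finite assms)
  interpret N: product_sigma_finite "\<lambda>_. N"
    by (intro product_sigma_finite.intro prob_space_imp_sigma_finite assms)
  have sts: "sets (Pi\<^sub>M J (\<lambda>_. M)) = sets (Pi\<^sub>M J (\<lambda>_. N))" for J
    by (intro sets_PiM_cong refl assms)
  have f: "f \<in> borel_measurable (Pi\<^sub>M (insert i I) (\<lambda>_. N))" by fact
  then have fM: "f \<in> borel_measurable (Pi\<^sub>M (insert i I) (\<lambda>_. M))"
    using measurable_cong_sets[OF sts refl] by blast
  have le: "scale_measure (ennreal c) M \<le> N"
  proof -
    have "ennreal c * emeasure M A \<le> emeasure N A" for A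
      using dom[of A] emeasure_notin_sets[of A M] assms(4) by (cases "A \<in> sets N") auto
    then show ?thesis
      using assms(4) sets_eq_imp_space_eq[OF assms(4)]
      by (simp add: le_measure_iff le_fun_def space_scale_measure)
  qed
  have inner: "ennreal c * (\<integral>\<^sup>+ y. g y \<partial>M) \<le> (\<integral>\<^sup>+ y. g y \<partial>N)"
    if "g \<in> borel_measurable N" for g
  proof -
    have "g \<in> borel_measurable M" using that measurable_cong_sets[OF assms(4) refl] by blast
    then have "ennreal c * (\<integral>\<^sup>+ y. g y \<partial>M) = (\<integral>\<^sup>+ y. g y \<partial>scale_measure (ennreal c) M)"
      by (simp add: nn_integral_scale_measure)
    also have "\<dots> \<le> (\<integral>\<^sup>+ y. g y \<partial>N)" using le assms(4) by (intro nn_integral_mono_measure) auto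
    finally show ?thesis .
  qed
  have upd: "(\<lambda>y. f (x(i := y))) \<in> borel_measurable N" if "x \<in> space (Pi\<^sub>M I (\<lambda>_. N))" for x
    using measurable_comp[OF measurable_component_update[OF that insert.hyps(2)] f] by (simp add: comp_def)
  have section_measurable: "(\<lambda>x. \<integral>\<^sup>+ y. f (x(i := y)) \<partial>K) \<in> borel_measurable (Pi\<^sub>M I (\<lambda>_. K))"
    if "sigma_finite_measure K" "f \<in> borel_measurable (Pi\<^sub>M (insert i I) (\<lambda>_. K))" for K
  proof -
    have "(\<lambda>(x, y). f (x(i := y))) \<in> borel_measurable (Pi\<^sub>M I (\<lambda>_. K) \<Otimes>\<^sub>M K)"
      using measurable_comp[OF measurable_add_dim that(2)] by (simp add: comp_def split_def)
    then show ?thesis by (rule sigma_finite_measure.borel_measurable_nn_integral[OF that(1)])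
  qed
  have "ennreal c ^ card (insert i I) * (\<integral>\<^sup>+ x. f x \<partial>Pi\<^sub>M (insert i I) (\<lambda>_. M))
      = ennreal c ^ card I * (ennreal c * (\<integral>\<^sup>+ x. (\<integral>\<^sup>+ y. f (x(i := y)) \<partial>M) \<partial>Pi\<^sub>M I (\<lambda>_. M)))"
    using insert.hyps by (simp add: M.product_nn_integral_insert[OF _ _ fM] mult_ac)
  also have "\<dots> = ennreal c ^ card I * (\<integral>\<^sup>+ x. ennreal c * (\<integral>\<^sup>+ y. f (x(i := y)) \<partial>M) \<partial>Pi\<^sub>M I (\<lambda>_. M))"
    by (subst nn_integral_cmult[OF section_measurable[OF M.sigma_finite_measures fM]]) (rule refl)
  also have "\<dots> \<le> ennreal c ^ card I * (\<integral>\<^sup>+ x. (\<integral>\<^sup>+ y. f (x(i := y)) \<partial>N) \<partial>Pi\<^sub>M I (\<lambda>_. M))"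
    using upd sets_eq_imp_space_eq[OF sts]
    by (intro mult_left_mono nn_integral_mono inner) auto
  also have "\<dots> \<le> (\<integral>\<^sup>+ x. (\<integral>\<^sup>+ y. f (x(i := y)) \<partial>N) \<partial>Pi\<^sub>M I (\<lambda>_. N))"
    by (rule insert.IH[OF section_measurable[OF N.sigma_finite_measures f]])
  also have "\<dots> = (\<integral>\<^sup>+ x. f x \<partial>Pi\<^sub>M (insert i I) (\<lambda>_. N))"
    by (rule N.product_nn_integral_insert[OF insert.hyps f, symmetric])
  finally show ?case .
qed

lemma pmf_binomial_eq_bmass: "0 \<le> p \<Longrightarrow> p \<le> 1 \<Longrightarrow> pmf (binomial_pmf m p) k = bmass m p k"
  by (simp add: bmass_def)

lemma exists_pmf_scaled:
  assumes "\<And>k. 0 \<le> f k" "\<And>k. k > m \<Longrightarrow> f k = 0" "(\<Sum>k\<le>m. f k) = c" "0 < c"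
  shows "\<exists>Q :: nat pmf. \<forall>k. c * pmf Q k = f k"
proof -
  have nn: "0 \<le> f k / c" for k using assms by simp
  have "(\<integral>\<^sup>+ k. ennreal (f k / c) \<partial>count_space UNIV) = (\<Sum>k\<le>m. ennreal (f k / c))"
    using assms(2) by (intro nn_integral_count_space') (auto simp: not_le)
  also have "\<dots> = ennreal (\<Sum>k\<le>m. f k / c)" using nn by (simp add: sum_ennreal)
  also have "\<dots> = 1" using assms by (simp flip: sum_divide_distrib)
  finally have "pmf (embed_pmf (\<lambda>k. f k / c)) k = f k / c" for k
    using nn by (intro pmf_embed_pmf)
  then show ?thesis using assms by (intro exI[of _ "embed_pmf (\<lambda>k. f k / c)"]) simp
qed

text \<open>A law on the natural numbers as a law on the reals.  All contaminations used below are of this form.\<close>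

definition real_law :: "nat pmf \<Rightarrow> real measure" where
  "real_law Q = distr (measure_pmf Q) borel real"

lemma real_law_in_real_dists: "real_law Q \<in> real_dists"
  by (auto simp: real_dists_def real_law_def intro!: prob_space.prob_space_distr measure_pmf.prob_space_axioms)

lemma emeasure_huber_real_law:
  assumes "0 \<le> e" "e \<le> 1" "0 \<le> p" "p \<le> 1" "A \<in> sets borel"
  shows "emeasure (huber m e p (real_law Q)) A
    = (\<integral>\<^sup>+ k. ennreal ((1 - e) * bmass m p k + e * pmf Q k) * indicator A (real k) \<partial>count_space UNIV)"
proof -
  have law: "emeasure (distr (measure_pmf Q) borel real) A
      = (\<integral>\<^sup>+ k. ennreal (pmf Q k) * indicator A (real k) \<partial>count_space UNIV)" for Q
  proof -
    have "emeasure (distr (measure_pmf Q) borel real) A = (\<integral>\<^sup>+ k. indicator (real -` A) k \<partial>measure_pmf Q)"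
      using assms(5) by (subst emeasure_distr) auto
    then show ?thesis by (simp add: nn_integral_measure_pmf indicator_def)
  qed
  have "emeasure (huber m e p (real_law Q)) A
      = ennreal (1 - e) * emeasure (distr (measure_pmf (binomial_pmf m p)) borel real) A
        + ennreal e * emeasure (distr (measure_pmf Q) borel real) A"
    using real_law_in_real_dists assms by (simp add: emeasure_huber binomial_real_def real_law_def)
  also have "\<dots> = (\<integral>\<^sup>+ k. ennreal (1 - e) * (ennreal (bmass m p k) * indicator A (real k))
      + ennreal e * (ennreal (pmf Q k) * indicator A (real k)) \<partial>count_space UNIV)"
    unfolding law using assms pmf_binomial_eq_bmass[OF assms(3,4)]
    by (simp add: nn_integral_add nn_integral_cmult del: pmf_binomial)
  also have "\<dots> = (\<integral>\<^sup>+ k. ennreal ((1 - e) * bmass m p k + e * pmf Q k) * indicator A (real k) \<partial>count_space UNIV)"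
    using assms bmass_nonneg[OF assms(3,4)]
    by (intro nn_integral_cong) (simp add: ennreal_plus ennreal_mult' distrib_right mult.assoc indicator_def)
  finally show ?thesis .
qed

text \<open>Domination of contaminated laws can be checked on point masses.\<close>

lemma emeasure_huber_mono:
  assumes "0 \<le> e" "e \<le> 1" "0 \<le> p" "p \<le> 1" "0 \<le> e'" "e' \<le> 1" "0 \<le> q" "q \<le> 1" "0 \<le> c" "A \<in> sets borel"
    and "\<And>k. c * ((1 - e) * bmass m p k + e * pmf S k) \<le> (1 - e') * bmass m q k + e' * pmf Q k"
  shows "ennreal c * emeasure (huber m e p (real_law S)) A \<le> emeasure (huber m e' q (real_law Q)) A"
proof -
  have "ennreal c * emeasure (huber m e p (real_law S)) A
      = (\<integral>\<^sup>+ k. ennreal (c * ((1 - e) * bmass m p k + e * pmf S k)) * indicator A (real k) \<partial>count_space UNIV)"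
    using assms by (simp add: emeasure_huber_real_law ennreal_mult' mult.assoc flip: nn_integral_cmult)
  also have "\<dots> \<le> (\<integral>\<^sup>+ k. ennreal ((1 - e') * bmass m q k + e' * pmf Q k) * indicator A (real k) \<partial>count_space UNIV)"
    using assms(11) by (intro nn_integral_mono mult_right_mono ennreal_leI) auto
  finally show ?thesis using assms by (simp add: emeasure_huber_real_law)
qed

lemma huber_prob_le:
  assumes "0 \<le> e" "e \<le> 1" "0 \<le> p" "p \<le> 1" "0 \<le> e'" "e' \<le> 1" "0 \<le> q" "q \<le> 1" "0 \<le> c"
    and "\<And>k. c * ((1 - e) * bmass m p k + e * pmf S k) \<le> (1 - e') * bmass m q k + e' * pmf Q k"
    and E: "{X \<in> space (Pi\<^sub>M {..<n} (\<lambda>_. borel)). E X} \<in> sets (Pi\<^sub>M {..<n} (\<lambda>_. borel :: real measure))"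
  shows "c ^ n * huber_prob n m e p (real_law S) E \<le> huber_prob n m e' q (real_law Q) E"
proof -
  let ?P = "huber_sample n m e p (real_law S)" and ?R = "huber_sample n m e' q (real_law Q)"
  let ?B = "Pi\<^sub>M {..<n} (\<lambda>_. borel :: real measure)"
  have st: "sets ?P = sets ?B" "sets ?R = sets ?B"
    by (auto simp: huber_sample_def intro!: sets_PiM_cong)
  note sp = st[THEN sets_eq_imp_space_eq]
  define F where "F = {X \<in> space ?B. E X}"
  have F: "F \<in> sets ?P" "F \<in> sets ?R" using E st by (auto simp: F_def)
  interpret P: prob_space ?P using assms real_law_in_real_dists by (intro prob_space_huber_sample) auto
  interpret R: prob_space ?R using assms real_law_in_real_dists by (intro prob_space_huber_sample) auto
  have "ennreal c ^ card {..<n} * (\<integral>\<^sup>+ x. indicator F x \<partial>?P) \<le> (\<integral>\<^sup>+ x. indicator F x \<partial>?R)"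
    unfolding huber_sample_def
    using assms F real_law_in_real_dists
    by (intro nn_integral_PiM_le prob_space_huber emeasure_huber_mono)
       (auto simp: huber_sample_def)
  then have "ennreal c ^ n * emeasure ?P F \<le> emeasure ?R F" using F by simp
  then have "c ^ n * measure ?P F \<le> measure ?R F"
    using assms by (simp add: P.emeasure_eq_measure R.emeasure_eq_measure ennreal_power flip: ennreal_mult)
  then show ?thesis by (simp add: huber_prob_def F_def sp)
qed

text \<open>A law with contamination level \<open>e\<close> also has every higher level \<open>e'\<close>: part of the binomial
  component is counted as contamination.\<close>

lemma exists_raised_contamination:
  assumes "0 \<le> e" "e \<le> e'" "0 \<le> p" "p \<le> 1" "set_pmf S \<subseteq> {..m}"
  shows "\<exists>Q. \<forall>k. (1 - e) * bmass m p k + e * pmf S k = (1 - e') * bmass m p k + e' * pmf Q k"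
proof (cases "e' = 0")
  case True
  then show ?thesis using assms by (intro exI[of _ S]) auto
next
  case False
  let ?f = "\<lambda>k. (e' - e) * bmass m p k + e * pmf S k"
  have "pmf S k = 0" if "k > m" for k using that assms(5) by (auto simp: pmf_eq_0_set_pmf)
  moreover have "(\<Sum>k\<le>m. ?f k) = e'"
    using assms(5) by (simp add: sum.distrib sum_bmass sum_pmf_eq_1 flip: sum_distrib_left)
  ultimately obtain Q :: "nat pmf" where "\<forall>k. e' * pmf Q k = ?f k"
    using exists_pmf_scaled[of ?f m e'] assms False bmass_nonneg[OF assms(3,4), of m]
    by (auto simp: bmass_outside)
  then show ?thesis by (intro exI[of _ Q]) (simp add: algebra_simps)
qed

section \<open>Confidence intervals and contaminated samples\<close>

context
  fixes n m :: nat and e p :: real and Q :: "real measure"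
  assumes Q: "Q \<in> real_dists" and e: "0 \<le> e" "e \<le> 1"
begin

lemma sets_huber_sample: "sets (huber_sample n m e p Q) = sets (Pi\<^sub>M {..<n} (\<lambda>_. borel))"
  by (auto simp: huber_sample_def intro!: sets_PiM_cong)

lemma space_huber_sample: "space (huber_sample n m e p Q) = space (Pi\<^sub>M {..<n} (\<lambda>_. borel :: real measure))"
  by (rule sets_eq_imp_space_eq[OF sets_huber_sample])

interpretation prob_space "huber_sample n m e p Q"
  by (rule prob_space_huber_sample[OF Q e])

lemma huber_prob_not:
  assumes "Measurable.pred (Pi\<^sub>M {..<n} (\<lambda>_. borel)) E"
  shows "huber_prob n m e p Q (\<lambda>X. \<not> E X) = 1 - huber_prob n m e p Q E"
  unfolding huber_prob_def
  by (rule prob_neg) (use assms sets_huber_sample space_huber_sample in \<open>simp add: pred_def\<close>)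

lemma huber_prob_mono:
  assumes "Measurable.pred (Pi\<^sub>M {..<n} (\<lambda>_. borel)) F" "\<And>X. E X \<Longrightarrow> F X"
  shows "huber_prob n m e p Q E \<le> huber_prob n m e p Q F"
  using assms sets_huber_sample space_huber_sample
  by (auto simp: huber_prob_def pred_def intro!: finite_measure_mono)

lemma huber_prob_union_bound:
  assumes "Measurable.pred (Pi\<^sub>M {..<n} (\<lambda>_. borel)) E" "Measurable.pred (Pi\<^sub>M {..<n} (\<lambda>_. borel)) F"
    "Measurable.pred (Pi\<^sub>M {..<n} (\<lambda>_. borel)) G"
    and "\<And>X. \<not> F X \<Longrightarrow> \<not> G X \<Longrightarrow> E X"
  shows "1 - huber_prob n m e p Q F - huber_prob n m e p Q G \<le> huber_prob n m e p Q E"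
proof -
  let ?A = "\<lambda>E. {X \<in> space (huber_sample n m e p Q). E X}"
  have s: "?A E \<in> events" "?A F \<in> events" "?A G \<in> events"
    using assms sets_huber_sample space_huber_sample by (auto simp: pred_def)
  have "1 = prob (?A E \<union> (?A F \<union> ?A G))"
  proof -
    have "?A E \<union> (?A F \<union> ?A G) = space (huber_sample n m e p Q)" using assms(4) by blast
    then show ?thesis by (simp add: prob_space)
  qed
  also have "\<dots> \<le> prob (?A E) + prob (?A F \<union> ?A G)"
    using s by (intro measure_Un_le) auto
  also have "prob (?A F \<union> ?A G) \<le> prob (?A F) + prob (?A G)"
    using s by (intro measure_Un_le) auto
  finally show ?thesis by (simp add: huber_prob_def)
qed

end

lemma ci_class_coverage:
  assumes "CI \<in> ci_class n m \<alpha> e" "0 \<le> e" "e \<le> 1" "0 \<le> p" "p \<le> 1" "Q \<in> real_dists"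
  shows "1 - \<alpha> \<le> huber_prob n m e p Q (\<lambda>X. p \<in> ci_set CI X)"
proof -
  have "(INF (p, Q) \<in> {0..1} \<times> real_dists. huber_prob n m e p Q (\<lambda>X. p \<in> ci_set CI X))
      \<le> huber_prob n m e p Q (\<lambda>X. p \<in> ci_set CI X)"
    using assms huber_prob_bounds
    by (intro cINF_lower2[where x = "(p, Q)"] bdd_belowI2[where m = 0]) auto
  then show ?thesis using assms(1) by (auto simp: ci_class_def)
qed

lemma ci_measurable:
  assumes "CI \<in> ci_class n m \<alpha> e"
  shows "Measurable.pred (Pi\<^sub>M {..<n} (\<lambda>_. borel)) (\<lambda>X. p \<in> ci_set CI X)"
    and "Measurable.pred (Pi\<^sub>M {..<n} (\<lambda>_. borel)) (\<lambda>X. r \<le> ci_length CI X)"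
proof -
  have [measurable]: "fst CI \<in> borel_measurable (Pi\<^sub>M {..<n} (\<lambda>_. borel))"
    "snd CI \<in> borel_measurable (Pi\<^sub>M {..<n} (\<lambda>_. borel))"
    using assms by (auto simp: ci_class_def)
  show "Measurable.pred (Pi\<^sub>M {..<n} (\<lambda>_. borel)) (\<lambda>X. p \<in> ci_set CI X)"
    unfolding ci_set_def atLeastAtMost_iff by measurable
  show "Measurable.pred (Pi\<^sub>M {..<n} (\<lambda>_. borel)) (\<lambda>X. r \<le> ci_length CI X)"
    unfolding ci_length_def by measurable
qed

text \<open>The margin \<open>b > \<alpha>\<close> has to be uniform over the intervals, since the definition of the optimal length
  takes an infimum over them.\<close>

lemma opt_length_ge:
  assumes "0 \<le> e" "e \<le> 1" "0 \<le> emax" "emax \<le> 1" "0 \<le> \<alpha>" "\<alpha> < b"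
    and long: "\<And>CI. CI \<in> ci_class n m \<alpha> emax \<Longrightarrow>
      \<exists>Q\<in>real_dists. b \<le> huber_prob n m e p Q (\<lambda>X. r0 \<le> ci_length CI X)"
  shows "r0 \<le> opt_length n m \<alpha> e p emax"
  unfolding opt_length_def
proof (rule cInf_greatest)
  show "{r. 0 \<le> r \<and> (INF CI \<in> ci_class n m \<alpha> emax. SUP Q \<in> real_dists.
        huber_prob n m e p Q (\<lambda>X. ci_length CI X \<ge> r)) \<le> \<alpha>} \<noteq> {}"
    using opt_length_feasible[OF assms(1-5), of n m p] by (intro ex_in_conv[THEN iffD1] exI[of _ 2]) simp
next
  fix r
  assume "r \<in> {r. 0 \<le> r \<and> (INF CI \<in> ci_class n m \<alpha> emax. SUP Q \<in> real_dists.
        huber_prob n m e p Q (\<lambda>X. ci_length CI X \<ge> r)) \<le> \<alpha>}"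
  then have r: "(INF CI \<in> ci_class n m \<alpha> emax. SUP Q \<in> real_dists.
        huber_prob n m e p Q (\<lambda>X. ci_length CI X \<ge> r)) \<le> \<alpha>" by simp
  show "r0 \<le> r"
  proof (rule ccontr)
    assume "\<not> r0 \<le> r"
    have "b \<le> (INF CI \<in> ci_class n m \<alpha> emax. SUP Q \<in> real_dists.
        huber_prob n m e p Q (\<lambda>X. ci_length CI X \<ge> r))"
    proof (rule cINF_greatest)
      show "ci_class n m \<alpha> emax \<noteq> {}" using ci_class_nonempty assms by blast
    next
      fix CI assume CI: "CI \<in> ci_class n m \<alpha> emax"
      obtain Q where Q: "Q \<in> real_dists" "b \<le> huber_prob n m e p Q (\<lambda>X. r0 \<le> ci_length CI X)"
        using long[OF CI] by blast
      note Q(2)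
      also have "huber_prob n m e p Q (\<lambda>X. r0 \<le> ci_length CI X)
          \<le> huber_prob n m e p Q (\<lambda>X. r \<le> ci_length CI X)"
        using \<open>\<not> r0 \<le> r\<close> assms by (intro huber_prob_mono Q ci_measurable[OF CI]) auto
      finally show "b \<le> (SUP Q \<in> real_dists. huber_prob n m e p Q (\<lambda>X. ci_length CI X \<ge> r))"
        using Q huber_prob_bounds[OF _ assms(1,2)]
        by (intro cSUP_upper2[where x = Q] bdd_aboveI2[where M = 1]) auto
    qed
    then show False using r assms by simp
  qed
qed

section \<open>The two-point argument\<close>

text \<open>If the excess at \<open>q\<close> is at most \<open>E\<close>, an interval covering at level \<open>emax\<close> must often contain both
  \<open>p\<close> and \<open>q\<close> under a contaminated law at \<open>p\<close>.  Let \<open>S\<close> be the normalised excess, \<open>P\<close> the law at \<open>p\<close>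
  contaminated by \<open>S\<close> at level \<open>e0\<close>, and \<open>R\<close> the law at \<open>p\<close> contaminated by \<open>S\<close> at the slightly higher
  level \<open>E\<close>.  Then \<open>R\<close> is also a law at \<open>q\<close> contaminated at level \<open>emax\<close>, and \<open>(1 - \<eta>) * P \<le> R\<close>.
  Hence \<open>q\<close> is missed under \<open>P\<close> with probability at most \<open>\<alpha> / (1 - \<eta>) ^ n\<close>.\<close>

lemma long_interval_probable:
  assumes "0 \<le> e0" "e0 \<le> e" "e \<le> emax" "0 < emax" "emax \<le> 1" "0 \<le> \<eta>" "\<eta> \<le> 1"
    and E: "1 - E = (1 - e0) * (1 - \<eta>)" "0 < E"
    and "0 \<le> p" "p \<le> 1" "0 \<le> q" "q \<le> 1"
    and exc: "excess m (1 - emax) q (1 - E) p \<le> E"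
    and pow: "0 < b" "b \<le> (1 - \<eta>) ^ n"
    and CI: "CI \<in> ci_class n m \<alpha> emax"
  shows "\<exists>Q\<in>real_dists. 1 - \<alpha> - \<alpha> / b \<le> huber_prob n m e p Q (\<lambda>X. \<bar>p - q\<bar> \<le> ci_length CI X)"
proof -
  define g where "g = (\<lambda>k. max 0 ((1 - emax) * bmass m q k - (1 - E) * bmass m p k))"
  have sg: "(\<Sum>k\<le>m. g k) = excess m (1 - emax) q (1 - E) p" by (simp add: g_def excess_def)
  have g_outside: "g k = 0" if "k > m" for k using that by (simp add: g_def bmass_outside)
  have g_nonneg: "0 \<le> g k" for k by (simp add: g_def)
  \<comment> \<open>The mass that the excess leaves unused is put at \<open>0\<close>.\<close>
  have "\<exists>S :: nat pmf. \<forall>k. E * pmf S k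
      = g k + (if k = 0 then E - excess m (1 - emax) q (1 - E) p else 0)"
    using g_outside g_nonneg exc E(2)
    by (intro exists_pmf_scaled[where m = m]) (auto simp: sum.distrib sg)
  then obtain S :: "nat pmf" where S: "\<And>k. E * pmf S k
      = g k + (if k = 0 then E - excess m (1 - emax) q (1 - E) p else 0)" by blast
  have S_outside: "pmf S k = 0" if "k > m" for k using S[of k] g_outside[OF that] that E(2) by simp
  have S_supp: "set_pmf S \<subseteq> {..m}" using S_outside by (auto simp: set_pmf_eq) (meson not_le)
  have S_ge: "(1 - emax) * bmass m q k \<le> (1 - E) * bmass m p k + E * pmf S k" for k
    using S[of k] exc unfolding g_def by (auto split: if_splits)
  \<comment> \<open>\<open>T\<close> is what remains of \<open>R\<close> after removing its component at \<open>q\<close>.\<close>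
  have "\<exists>T :: nat pmf. \<forall>k. emax * pmf T k
      = (1 - E) * bmass m p k + E * pmf S k - (1 - emax) * bmass m q k"
    using S_ge S_outside S_supp assms
    by (intro exists_pmf_scaled[where m = m])
       (auto simp: bmass_outside sum.distrib sum_subtractf sum_bmass sum_pmf_eq_1 simp flip: sum_distrib_left)
  then obtain T where T: "\<And>k. emax * pmf T k
      = (1 - E) * bmass m p k + E * pmf S k - (1 - emax) * bmass m q k" by blast
  \<comment> \<open>\<open>P\<close> written at level \<open>emax\<close>, where coverage holds, and at level \<open>e\<close>, where the length is measured.\<close>
  obtain S1 where S1: "\<And>k. (1 - e0) * bmass m p k + e0 * pmf S k = (1 - emax) * bmass m p k + emax * pmf S1 k"
    using exists_raised_contamination[OF _ _ _ _ S_supp, of e0 emax p] assms by auto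
  obtain S2 where S2: "\<And>k. (1 - e0) * bmass m p k + e0 * pmf S k = (1 - e) * bmass m p k + e * pmf S2 k"
    using exists_raised_contamination[OF _ _ _ _ S_supp, of e0 e p] assms by auto
  let ?P = "huber_prob n m e0 p (real_law S)"
  note meas = ci_measurable[OF CI]
  have meas_not: "Measurable.pred (Pi\<^sub>M {..<n} (\<lambda>_. borel)) (\<lambda>X. x \<notin> ci_set CI X)" for x
    using meas(1)[of x] by measurable
  have miss: "huber_prob n m emax x (real_law U) (\<lambda>X. x \<notin> ci_set CI X) \<le> \<alpha>"
    if "0 \<le> x" "x \<le> 1" for x U
    using ci_class_coverage[OF CI _ _ that real_law_in_real_dists[of U]] assms
      huber_prob_not[OF real_law_in_real_dists _ _ meas(1), of emax] by simp
  have p_miss: "?P (\<lambda>X. p \<notin> ci_set CI X) \<le> \<alpha>"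
  proof -
    have "1 ^ n * ?P (\<lambda>X. p \<notin> ci_set CI X) \<le> huber_prob n m emax p (real_law S1) (\<lambda>X. p \<notin> ci_set CI X)"
      using assms S1 meas_not[of p] by (intro huber_prob_le) (auto simp: pred_def)
    then show ?thesis using miss[of p S1] assms by simp
  qed
  have q_miss: "?P (\<lambda>X. q \<notin> ci_set CI X) \<le> \<alpha> / b"
  proof -
    have "(1 - \<eta>) * ((1 - e0) * bmass m p k + e0 * pmf S k) \<le> (1 - emax) * bmass m q k + emax * pmf T k" for k
    proof -
      have "(1 - \<eta>) * e0 \<le> E" using E assms(6) by (simp add: algebra_simps)
      then have "(1 - \<eta>) * e0 * pmf S k \<le> E * pmf S k" by (intro mult_right_mono) auto
      then show ?thesis using T[of k] E(1) by (simp add: algebra_simps)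
    qed
    then have "(1 - \<eta>) ^ n * ?P (\<lambda>X. q \<notin> ci_set CI X) \<le> huber_prob n m emax q (real_law T) (\<lambda>X. q \<notin> ci_set CI X)"
      using assms meas_not[of q] by (intro huber_prob_le) (auto simp: pred_def)
    then have "(1 - \<eta>) ^ n * ?P (\<lambda>X. q \<notin> ci_set CI X) \<le> \<alpha>" using miss[of q T] assms by simp
    moreover have "b * ?P (\<lambda>X. q \<notin> ci_set CI X) \<le> (1 - \<eta>) ^ n * ?P (\<lambda>X. q \<notin> ci_set CI X)"
      using pow huber_prob_bounds[OF real_law_in_real_dists, of e0] assms by (intro mult_right_mono) auto
    ultimately show ?thesis using pow by (simp add: field_simps)
  qed
  have "1 - \<alpha> - \<alpha> / b \<le> 1 - ?P (\<lambda>X. p \<notin> ci_set CI X) - ?P (\<lambda>X. q \<notin> ci_set CI X)"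
    using p_miss q_miss by simp
  also have "\<dots> \<le> ?P (\<lambda>X. \<bar>p - q\<bar> \<le> ci_length CI X)"
    using assms meas_not meas
    by (intro huber_prob_union_bound real_law_in_real_dists) (auto simp: ci_set_def ci_length_def)
  also have "1 ^ n * \<dots> \<le> huber_prob n m e p (real_law S2) (\<lambda>X. \<bar>p - q\<bar> \<le> ci_length CI X)"
    using assms S2 meas(2)[of "\<bar>p - q\<bar>"] by (intro huber_prob_le) (auto simp: pred_def)
  finally show ?thesis using real_law_in_real_dists by auto
qed

section \<open>Comparison with the rate\<close>

lemma rate_le_separation_of_factors:
  assumes "0 \<le> p" "p \<le> 1" "1 \<le> m" "0 \<le> x" "0 \<le> y" "0 < L"
    and "1 / sqrt (ln (real n)) \<le> x / sqrt L" "inv_sqrt_log_inv e \<le> y / sqrt L" "1 / real n + e \<le> z * E"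
    and "L = ln (1 / E)" "x + y \<le> K" "z \<le> K" "1 \<le> K" "0 \<le> E"
  shows "rate n e m p \<le> K * separation m E p"
proof -
  define s where "s = sqrt (p * (1 - p) / real m)"
  have s: "0 \<le> s" using assms by (simp add: s_def)
  have "s * (1 / sqrt (ln (real n)) + inv_sqrt_log_inv e) \<le> s * (K / sqrt L)"
  proof (rule mult_left_mono[OF _ s])
    have "1 / sqrt (ln (real n)) + inv_sqrt_log_inv e \<le> (x + y) / sqrt L"
      using assms by (simp add: add_divide_distrib)
    also have "\<dots> \<le> K / sqrt L" using assms by (intro divide_right_mono) auto
    finally show "1 / sqrt (ln (real n)) + inv_sqrt_log_inv e \<le> K / sqrt L" .
  qed
  moreover have "1 * (1 / real m) \<le> K * (1 / real m)" using assms by (intro mult_right_mono) auto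
  ultimately have 1: "s * (1 / sqrt (ln (real n)) + inv_sqrt_log_inv e) + 1 / real m
      \<le> K * (s / sqrt L + 1 / real m)" by (simp add: algebra_simps)
  have 2: "p \<le> K * p" "1 - p \<le> K * (1 - p)"
    using mult_right_mono[of 1 K p] mult_right_mono[of 1 K "1 - p"] assms by auto
  have "1 / real n + e \<le> K * E" using assms mult_right_mono[of z K E] by linarith
  then have 3: "1 / real m * (1 / real n + e) \<le> K * (E / real m)"
    using assms divide_right_mono[of "1 / real n + e" "K * E" "real m"] by simp
  have "min (min (s * (1 / sqrt (ln (real n)) + inv_sqrt_log_inv e) + 1 / real m) p) (1 - p)
      \<le> min (min (K * (s / sqrt L + 1 / real m)) (K * p)) (K * (1 - p))"
    using 1 2 by (intro min.mono) auto
  also have "\<dots> = K * min (min (s / sqrt L + 1 / real m) p) (1 - p)"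
    using assms by (simp add: min_mult_distrib_left)
  finally show ?thesis
    using 3 unfolding rate_def separation_def s_def assms(10) by (simp add: distrib_left)
qed

text \<open>The level \<open>E\<close> only has to be at least of the order of both \<open>1 / n\<close> and \<open>e\<close>.\<close>

lemma rate_le_separation:
  assumes "0 \<le> p" "p \<le> 1" "1 \<le> m" "3 \<le> n" "0 \<le> e" "e \<le> 1/2" "0 < \<alpha>" "\<alpha> < 1"
    and "\<alpha> / (2 * real n) \<le> E" "e / 2 \<le> E" "E \<le> 1/2"
  shows "rate n e m p \<le> (sqrt (1 + ln (2 / \<alpha>)) + sqrt 2 + (2 + 2 / \<alpha>)) * separation m E p"
proof -
  define L where "L = ln (1 / E)"
  have En: "0 < \<alpha> / (2 * real n)" using assms by simp
  then have E: "0 < E" using assms by linarith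
  have L: "1/2 \<le> L" using ln_inverse_ge_half[OF E assms(11)] by (simp add: L_def)
  have l2: "0 \<le> ln (2 / \<alpha>)" using assms by simp
  have lnn: "1 \<le> ln (real n)"
  proof -
    have "exp 1 \<le> real n" using exp_le assms by linarith
    then show ?thesis using assms by (simp add: ln_ge_iff)
  qed
  have "L \<le> ln (1 / (\<alpha> / (2 * real n)))"
    unfolding L_def
    by (intro ln_mono divide_left_mono mult_pos_pos divide_pos_pos[OF zero_less_one] E En assms(9) zero_le_one)
  also have "\<dots> = ln (2 / \<alpha> * real n)" by (simp add: field_simps)
  also have "\<dots> = ln (2 / \<alpha>) + ln (real n)" using assms by (intro ln_mult_pos) auto
  also have "\<dots> \<le> (1 + ln (2 / \<alpha>)) * ln (real n)"
    using mult_left_mono[OF lnn l2] by (simp add: algebra_simps)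
  finally have "sqrt L \<le> sqrt (1 + ln (2 / \<alpha>)) * sqrt (ln (real n))"
    by (simp flip: real_sqrt_mult)
  then have n: "1 / sqrt (ln (real n)) \<le> sqrt (1 + ln (2 / \<alpha>)) / sqrt L"
    using lnn L by (simp add: field_simps)
  have e: "inv_sqrt_log_inv e \<le> sqrt 2 / sqrt L"
  proof (cases "e = 0")
    case True
    then show ?thesis using L by (simp add: inv_sqrt_log_inv_def)
  next
    case False
    then have e: "0 < e" using assms by simp
    have "L \<le> ln (1 / (e / 2))"
      unfolding L_def using assms E e by (intro ln_mono divide_left_mono) auto
    also have "\<dots> = ln (2 * (1 / e))" by simp
    also have "\<dots> = ln 2 + ln (1 / e)" using e by (intro ln_mult_pos) auto
    also have "ln 2 \<le> ln (1 / e)" using e assms by (intro ln_mono) (auto simp: field_simps)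
    finally have Le: "L \<le> 2 * ln (1 / e)" by simp
    then have "sqrt L \<le> sqrt 2 * sqrt (ln (1 / e))" by (simp flip: real_sqrt_mult)
    then show ?thesis using False Le L by (simp add: inv_sqrt_log_inv_def field_simps)
  qed
  have z: "1 / real n + e \<le> (2 + 2 / \<alpha>) * E"
  proof -
    have "1 / real n = 2 / \<alpha> * (\<alpha> / (2 * real n))" using assms by simp
    also have "\<dots> \<le> 2 / \<alpha> * E" using assms by (intro mult_left_mono) auto
    finally show ?thesis using assms by (simp add: algebra_simps)
  qed
  show ?thesis
    by (rule rate_le_separation_of_factors[OF assms(1-3) _ _ _ n e z L_def])
       (use l2 L E assms in auto)
qed

section \<open>The lower bound\<close>

theorem theorem1:
  fixes \<alpha> \<epsilon>max :: real
  assumes "0 < \<alpha>" "\<alpha> < 1/4"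
    and "0 \<le> \<epsilon>max" "\<epsilon>max \<le> 1/2"
  shows "\<exists>c>0. \<forall>(m::nat) (n::nat) (\<epsilon>::real) (p::real).
    1 \<le> m \<longrightarrow> 3 \<le> n \<longrightarrow> \<epsilon>max \<ge> 2 * \<alpha> / real n \<longrightarrow>
    0 \<le> \<epsilon> \<longrightarrow> \<epsilon> \<le> \<epsilon>max \<longrightarrow> 0 \<le> p \<longrightarrow> p \<le> 1 \<longrightarrow>
    opt_length n m \<alpha> \<epsilon> p \<epsilon>max \<ge> c * rate n \<epsilon> m p"
proof (cases "\<epsilon>max = 0")
  case True
  \<comment> \<open>The hypothesis \<open>2 * \<alpha> / n \<le> \<epsilon>max\<close> then fails for all \<open>n\<close>.\<close>
  then show ?thesis using assms by (intro exI[of _ 1]) (auto simp: field_simps)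
next
  case False
  then have emax: "0 < \<epsilon>max" using assms by simp
  define a where "a = ln (1 + \<epsilon>max / 4)"
  define K where "K = sqrt (1 + ln (2 / \<alpha>)) + sqrt 2 + (2 + 2 / \<alpha>)"
  have a: "0 < a" "a \<le> 1"
    using emax assms ln_add_one_self_le_self[of "\<epsilon>max / 4"] by (auto simp: a_def)
  have "0 \<le> ln (2 / \<alpha>)" using assms by simp
  then have K: "0 < K" using assms unfolding K_def by (intro add_nonneg_pos add_nonneg_nonneg) auto
  show ?thesis
  proof (intro exI[of _ "a / 9 / K"] conjI allI impI)
    show "0 < a / 9 / K" using a K by simp
  next
    fix m n :: nat and \<epsilon> p :: real
    assume mn: "1 \<le> m" "3 \<le> n" "2 * \<alpha> / real n \<le> \<epsilon>max" and e: "0 \<le> \<epsilon>" "\<epsilon> \<le> \<epsilon>max"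
      and p: "0 \<le> p" "p \<le> 1"
    \<comment> \<open>\<open>\<eta> \<le> \<epsilon>max / 4\<close> is where \<open>2 * \<alpha> / n \<le> \<epsilon>max\<close> enters.  Capping the level at
      \<open>\<epsilon>max / 2\<close> keeps \<open>E \<le> 3 / 4 * \<epsilon>max\<close>, so \<open>(1 - E) / (1 - \<epsilon>max)\<close> stays at least \<open>exp a > 1\<close>.\<close>
    define \<eta> where "\<eta> = \<alpha> / (2 * real n)"
    define e0 where "e0 = min \<epsilon> (\<epsilon>max / 2)"
    define E where "E = 1 - (1 - e0) * (1 - \<eta>)"
    have eta: "0 < \<eta>" "\<eta> \<le> \<epsilon>max / 4" using mn assms by (auto simp: \<eta>_def field_simps)
    have e0: "0 \<le> e0" "e0 \<le> \<epsilon>max / 2" "e0 \<le> \<epsilon>" "\<epsilon> / 2 \<le> e0" using e by (auto simp: e0_def)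
    have prods: "0 \<le> e0 * \<eta>" "0 \<le> (1 - e0) * \<eta>" "0 \<le> e0 * (1 - \<eta>)"
      using eta e0 assms by auto
    then have E: "E \<le> e0 + \<eta>" "e0 \<le> E" "\<eta> \<le> E" by (auto simp: E_def algebra_simps)
    have "(1 - \<epsilon>max) * exp a = 1 - 3/4 * \<epsilon>max - \<epsilon>max * \<epsilon>max / 4"
      using emax by (simp add: a_def) (simp add: field_simps)
    also have "\<dots> \<le> 1 - E" using E eta e0 zero_le_square[of \<epsilon>max] by linarith
    finally obtain q where q: "0 \<le> q" "q \<le> 1" "excess m (1 - \<epsilon>max) q (1 - E) p \<le> E"
        "a / 9 * separation m E p \<le> \<bar>p - q\<bar>"
      using exists_shift[OF mn(1) p a, of E "1 - \<epsilon>max" "1 - E"] E eta e0 assms by auto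
    have pow: "1 - \<alpha> / 2 \<le> (1 - \<eta>) ^ n"
      using Bernoulli_inequality[of "- \<eta>" n] eta assms mn by (simp add: \<eta>_def)
    \<comment> \<open>This is where \<open>\<alpha> < 1/4\<close> enters; the margin depends on \<open>\<alpha>\<close> alone.\<close>
    have "\<alpha> < 1 - \<alpha> - \<alpha> / (1 - \<alpha> / 2)"
    proof -
      have "\<alpha> / (1 - \<alpha> / 2) \<le> \<alpha> / (7/8)" using assms by (intro divide_left_mono) auto
      then show ?thesis using assms by simp
    qed
    moreover have "\<exists>Q\<in>real_dists. 1 - \<alpha> - \<alpha> / (1 - \<alpha> / 2)
        \<le> huber_prob n m \<epsilon> p Q (\<lambda>X. \<bar>p - q\<bar> \<le> ci_length CI X)"
      if "CI \<in> ci_class n m \<alpha> \<epsilon>max" for CI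
      by (rule long_interval_probable[OF e0(1,3) e(2) emax _ _ _ _ _ p q(1-3) _ pow that])
         (use assms eta e0 E q(3) in \<open>auto simp: E_def\<close>)
    ultimately have "\<bar>p - q\<bar> \<le> opt_length n m \<alpha> \<epsilon> p \<epsilon>max"
      using e assms by (intro opt_length_ge) auto
    moreover have "a / 9 / K * rate n \<epsilon> m p \<le> a / 9 * separation m E p"
    proof -
      have "rate n \<epsilon> m p \<le> K * separation m E p"
        unfolding K_def using p mn e assms E e0 eta
        by (intro rate_le_separation) (auto simp: \<eta>_def)
      then have "a / 9 / K * rate n \<epsilon> m p \<le> a / 9 / K * (K * separation m E p)"
        using a K by (intro mult_left_mono) auto
      then show ?thesis using K by simp
    qed
    ultimately show "a / 9 / K * rate n \<epsilon> m p \<le> opt_length n m \<alpha> \<epsilon> p \<epsilon>max"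
      using q(4) by linarith
  qed
qed

end
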